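(* Let $\xi\in L^\infty(D;\mathbb{C}^{d\times d})$ be a normal $d$-by-$d$ tensor field. For all $\mathbf{x}\in D$, let $\lambda_1(\mathbf{x}),\dots,\lambda_d(\mathbf{x})\in\mathbb{C}$ be the eigenvalues of $\xi(\mathbf{x})$, represented as $\lambda_j(\mathbf{x})=|\lambda_j(\mathbf{x})|e^{i\beta_j(\mathbf{x})}$ with $\beta_j(\mathbf{x})\in\mathbb{R}$ for $j=1,\dots,d$. (a) The tensor field $\xi$ is elliptic if and only if $\inf_{\mathbf{x}\in D}|\xi(\mathbf{x})|>0$ and there exist $\theta_\xi\in\mathbb{R}$ and $\eta_\xi\in\,]0,\pi/2]$ such that, for almost every $\mathbf{x}\in D$, $$\theta_\xi+\beta_j(\mathbf{x})\in\bigcup_{n\in\mathbb{Z}}\big[2n\pi-(\pi/2-\eta_\xi),\ 2n\pi+(\pi/2-\eta_\xi)\big]\quad\text{for } j=1,\dots,d.$$ In addition, when $\xi$ is elliptic, $\eta_\xi$ can be chosen arbitrarily close to $0$. (b) If $\inf_{\mathbf{x}\in D}|\xi(\mathbf{x})|>0$ and, for almost every $\mathbf{x}\in D$, $\beta_j(\mathbf{x})\in[\beta_-,\beta_+]\subset\mathbb{R}$ for all $j=1,\dots,d$, with $\beta_+-\beta_-<\pi$, then $\xi$ is elliptic and every angle $$\theta_\xi\in\bigcup_{n\in\mathbb{Z}}\,\big]2n\pi-\pi/2-\beta_-,\ 2n\pi+\pi/2-\beta_+\big[$$ is an ellipticity direction of $\xi$. (c) If, in addition to the hypotheses of (b), there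 exist indices $j_-,j_+\in\{1,\dots,d\}$ and points $\mathbf{x}_-,\mathbf{x}_+\in D$ such that $\beta_{j_-}(\mathbf{x}_-)=\beta_-$ and $\beta_{j_+}(\mathbf{x}_+)=\beta_+$, then there is no ellipticity direction of $\xi$ outside the set $\bigcup_{n\in\mathbb{Z}}\,]2n\pi-\pi/2-\beta_-,\ 2n\pi+\pi/2-\beta_+[$.
   Context: $D$ is a bounded subset of $\mathbb{R}^3$ and $d\in\{1,2,3\}$. For a matrix $\xi(\mathbf{x})\in\mathbb{C}^{d\times d}$, $|\xi(\mathbf{x})|:=\sup_{\mathbf{z}\in\mathbb{C}^d\setminus\{0\}}|\xi(\mathbf{x})\mathbf{z}|/|\mathbf{z}|$. $L^\infty(D;\mathbb{C}^{d\times d})$ is the space of Lebesgue-measurable complex $d$-by-$d$ tensor (matrix) fields $\xi$ on $D$ with $\operatorname{ess\,sup}_{\mathbf{x}\in D}|\xi(\mathbf{x})|<\infty$. The field is normal if its values $\xi(\mathbf{x})$ are normal matrices. The field $\xi$ is elliptic if there exist $\theta_\xi\in\mathbb{R}$ and $\xi_->0$ such that, for almost every $\mathbf{x}\in D$ and all $\mathbf{z}\in\mathbb{C}^d$, $\mathrm{Re}\{e^{i\theta_\xi}(\xi(\mathbf{x})\mathbf{z})\cdot\overline{\mathbf{z}}\}\ge\xi_-|\mathbf{z}|^2$. An ellipticity direction of $\xi$ is an angle $\theta_\xi\in\mathbb{R}$ for which such a $\xi_->0$ exists. Here $i$ is the imaginary unit and open intervals are written $]a,b[$.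
   Formalization: inf|ξ(x)|>0 becomes ess inf over x of inf_{z≠0}|ξ(x)z|/|z| > 0 (else ξ=diag(1,0) is a counterexample); elliptic ⇒ ess inf|ξ|>0 is kept. In (c), β_- and β_+ must also be essential values of β_{j_-} and β_{j_+} on D, since values at single points do not suffice. *)

theory Defs
  imports "HOL-Analysis.Analysis" "HOL-Probability.Essential_Supremum"
begin

text \<open>
  Points of space have type \<open>real ^ 3\<close>; a tensor field on \<open>D\<close> is a function
  \<open>\<xi> :: real ^ 3 \<Rightarrow> complex ^ 'd ^ 'd\<close> whose values outside \<open>D\<close> are irrelevant.
  ``Almost every point of \<open>D\<close>'' refers to \<open>lebesgue_on D\<close>.
\<close>

definition tensor_norm :: "complex ^ 'd ^ 'd \<Rightarrow> real"
  where "tensor_norm A = onorm (\<lambda>z. A *v z)"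

text \<open>
  The best constant \<open>c\<close> in the lower bound \<open>norm (A *v z) \<ge> c * norm z\<close>, as
  \<^const>\<open>onorm\<close> is the best constant in the upper bound.  For \<open>d = 1\<close> it equals
  \<open>tensor_norm A\<close>.  For \<open>d \<ge> 2\<close> the operator norm is not a lower bound in this sense:
  the constant field with diagonal entries \<open>1, 0\<close> has operator norm \<open>1\<close>, and the zero
  eigenvalue is represented by any angle, but the field is not elliptic.
\<close>
definition tensor_lower_bound :: "complex ^ 'd ^ 'd \<Rightarrow> real"
  where "tensor_lower_bound A = (INF z\<in>UNIV - {0}. norm (A *v z) / norm z)"

definition essinf :: "'a measure \<Rightarrow> ('a \<Rightarrow> ereal) \<Rightarrow> ereal"
  where "essinf M f = - esssup M (\<lambda>x. - f x)"

definition Linfty_tensor :: "(real ^ 3) set \<Rightarrow> (real ^ 3 \<Rightarrow> complex ^ 'd ^ 'd) \<Rightarrow> bool"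
  where "Linfty_tensor D \<xi> \<longleftrightarrow>
    \<xi> \<in> borel_measurable (lebesgue_on D) \<and>
    esssup (lebesgue_on D) (\<lambda>x. ereal (tensor_norm (\<xi> x))) < \<infinity>"

definition normal_matrix :: "complex ^ 'd ^ 'd \<Rightarrow> bool"
  where "normal_matrix A \<longleftrightarrow>
    A ** transpose (map_matrix cnj A) = transpose (map_matrix cnj A) ** A"

text \<open>
  \<open>l\<close> lists the eigenvalues of \<open>A\<close>, each repeated according to its algebraic multiplicity.
\<close>
definition eigenvalue_family :: "complex ^ 'd ^ 'd \<Rightarrow> ('d \<Rightarrow> complex) \<Rightarrow> bool"
  where "eigenvalue_family A l \<longleftrightarrow> (\<forall>t. det (mat t - A) = (\<Prod>j\<in>UNIV. t - l j))"

definition ellipticity_direction ::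
    "(real ^ 3) set \<Rightarrow> (real ^ 3 \<Rightarrow> complex ^ 'd ^ 'd) \<Rightarrow> real \<Rightarrow> bool"
  where "ellipticity_direction D \<xi> \<theta> \<longleftrightarrow>
    (\<exists>c>0. AE x in lebesgue_on D. \<forall>z :: complex ^ 'd.
      c * (norm z)\<^sup>2 \<le>
        Re (exp (\<i> * complex_of_real \<theta>) * (\<Sum>k\<in>UNIV. (\<xi> x *v z) $ k * cnj (z $ k))))"

definition elliptic :: "(real ^ 3) set \<Rightarrow> (real ^ 3 \<Rightarrow> complex ^ 'd ^ 'd) \<Rightarrow> bool"
  where "elliptic D \<xi> \<longleftrightarrow> (\<exists>\<theta>. ellipticity_direction D \<xi> \<theta>)"

text \<open>The angles \<open>\<beta> j\<close> lie, up to \<open>\<theta>\<close>, in the sector of the right half-plane with margin \<open>\<eta>\<close>.\<close>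
definition angles_in_sector ::
    "(real ^ 3) set \<Rightarrow> ('d::finite \<Rightarrow> real ^ 3 \<Rightarrow> real) \<Rightarrow> real \<Rightarrow> real \<Rightarrow> bool"
  where "angles_in_sector D \<beta> \<theta> \<eta> \<longleftrightarrow>
    (AE x in lebesgue_on D. \<forall>j. \<theta> + \<beta> j x \<in>
      (\<Union>n::int. {2 * of_int n * pi - (pi / 2 - \<eta>) .. 2 * of_int n * pi + (pi / 2 - \<eta>)}))"

text \<open>
  \<open>v\<close> is in the essential range of \<open>f\<close> on \<open>D\<close>: no neighbourhood of \<open>v\<close> is avoided almost
  everywhere.  This does not require \<open>f\<close> to be measurable.  It holds if \<open>f\<close> takes the value
  \<open>v\<close> on a non-null subset of \<open>D\<close>, or if \<open>f x = v\<close> at a point \<open>x\<close> of \<open>D\<close> where \<open>f\<close> is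
  continuous and every neighbourhood of which meets \<open>D\<close> in a non-null set.
\<close>
definition essential_value :: "(real ^ 3) set \<Rightarrow> (real ^ 3 \<Rightarrow> real) \<Rightarrow> real \<Rightarrow> bool"
  where "essential_value D f v \<longleftrightarrow>
    (\<forall>\<epsilon>>0. \<not> (AE x in lebesgue_on D. \<bar>f x - v\<bar> \<ge> \<epsilon>))"

end

(*
  A normal operator f = H + iK splits into commuting Hermitian parts H and K.  The least
  eigenvalue \<mu> of H, a minimum of its Rayleigh quotient, has a K-invariant eigenspace, in
  which K has an eigenvector; this is an eigenvector of f with eigenvalue of real part \<mu>.
  So the real part of the form of f is bounded below by the least real part of an eigenvalue
  of f.  Applied to exp(i\<theta>) \<xi>(x), this turns ellipticity in the direction \<theta> into a uniform
  positive lower bound on |\<lambda>_j(x)| cos(\<theta> + \<beta>_j(x)).  As the |\<lambda>_j(x)| are bounded above, and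
  bounded below by the best lower bound of \<xi>(x), only the cosines matter.
*)
theory Submission
  imports Defs
begin

lemma symmetric_linear_min_eigenvector:
  fixes T :: "'a::euclidean_space \<Rightarrow> 'a"
  assumes T: "linear T" and sym: "\<And>x y. T x \<bullet> y = x \<bullet> T y"
    and E: "subspace E" "E \<noteq> {0}" "T ` E \<subseteq> E"
  obtains v \<mu> where "v \<in> E" "v \<noteq> 0" "T v = \<mu> *\<^sub>R v"
    "\<And>z. z \<in> E \<Longrightarrow> \<mu> * (norm z)\<^sup>2 \<le> T z \<bullet> z"
proof -
  let ?S = "E \<inter> sphere 0 1"
  obtain u where u: "u \<in> E" "u \<noteq> 0"
    using E(1,2) subspace_0 by blast
  have "(1 / norm u) *\<^sub>R u \<in> ?S"
    using u E(1) by (simp add: subspace_scale)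
  then have "?S \<noteq> {}" by blast
  moreover have "compact ?S"
    by (simp add: closed_Int_compact closed_subspace E(1))
  moreover have "continuous_on ?S (\<lambda>z. T z \<bullet> z)"
    by (intro continuous_on_inner continuous_on_id linear_continuous_on)
      (simp add: T linear_linear)
  ultimately obtain v where v: "v \<in> ?S" and min: "\<And>z. z \<in> ?S \<Longrightarrow> T v \<bullet> v \<le> T z \<bullet> z"
    using continuous_attains_inf[of ?S "\<lambda>z. T z \<bullet> z"] by blast
  define \<mu> where "\<mu> = T v \<bullet> v"
  have bound: "\<mu> * (norm z)\<^sup>2 \<le> T z \<bullet> z" if "z \<in> E" for z
  proof (cases "z = 0")
    case False
    have "\<mu> \<le> T ((1 / norm z) *\<^sub>R z) \<bullet> ((1 / norm z) *\<^sub>R z)"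
      unfolding \<mu>_def using that False E(1) by (intro min) (simp add: subspace_scale)
    also have "\<dots> = (T z \<bullet> z) / (norm z)\<^sup>2"
      by (simp add: linear_scale[OF T] power2_eq_square)
    finally show ?thesis using False by (simp add: field_simps)
  qed (simp add: linear_0[OF T])
  define w where "w = T v - \<mu> *\<^sub>R v"
  have w: "w \<in> E"
    unfolding w_def using v E by (intro subspace_diff subspace_scale) auto
  have norm_v: "norm v = 1" using v by simp
  have vv: "v \<bullet> v = 1" "T v \<bullet> v = \<mu>"
    using norm_v by (simp_all add: \<mu>_def norm_eq_1)
  define q where "q = T w \<bullet> w - \<mu> * (w \<bullet> w)"
  have Tw: "T w \<bullet> v = T v \<bullet> w"
    using sym[of v w] by (simp add: inner_commute)
  have quad: "0 \<le> 2 * t * (w \<bullet> w) + t\<^sup>2 * q" for t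
  proof -
    let ?z = "v + t *\<^sub>R w"
    have "?z \<in> E" using v w E(1) by (simp add: subspace_add subspace_scale)
    then have "0 \<le> T ?z \<bullet> ?z - \<mu> * (?z \<bullet> ?z)"
      using bound[of ?z] by (simp add: power2_norm_eq_inner)
    also have "\<dots> = 2 * t * ((T v - \<mu> *\<^sub>R v) \<bullet> w) + t\<^sup>2 * q"
      by (simp add: linear_add[OF T] linear_scale[OF T] inner_add_left inner_add_right
          inner_diff_left Tw vv inner_commute[of w v] q_def power2_eq_square algebra_simps)
    finally show ?thesis by (simp add: w_def)
  qed
  have "w = 0"
  proof (rule ccontr)
    assume "w \<noteq> 0"
    then have pos: "w \<bullet> w > 0" by simp
    define t where "t = - (w \<bullet> w) / (\<bar>q\<bar> + 1)"
    have t: "t * (\<bar>q\<bar> + 1) = - (w \<bullet> w)" by (simp add: t_def)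
    have "t < 0" using pos by (simp add: t_def)
    have "t\<^sup>2 * q \<le> t\<^sup>2 * (\<bar>q\<bar> + 1)" by (intro mult_left_mono) auto
    also have "\<dots> = - t * (w \<bullet> w)" using t by (simp add: power2_eq_square mult.assoc)
    finally have "2 * t * (w \<bullet> w) + t\<^sup>2 * q \<le> t * (w \<bullet> w)" by (simp add: algebra_simps)
    also have "\<dots> < 0" using \<open>t < 0\<close> pos by (rule mult_neg_pos)
    finally show False using quad[of t] by simp
  qed
  then have "T v = \<mu> *\<^sub>R v" by (simp add: w_def)
  moreover have "v \<in> E" "v \<noteq> 0" using v by auto
  ultimately show thesis using bound that by blast
qed

lemma scaleR_eq_vector_smult: "r *\<^sub>R (x :: complex ^ 'n) = complex_of_real r *s x"
  by (simp add: vec_eq_iff) (simp add: scaleR_conv_of_real)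

lemma inner_vector_smult_left:
  fixes x y :: "complex ^ 'n"
  shows "(a *s x) \<bullet> y = x \<bullet> (cnj a *s y)"
  by (auto simp: inner_vec_def inner_complex_def algebra_simps intro!: sum.cong)

lemma matrix_vector_mult_adjoint:
  fixes A :: "complex ^ 'n ^ 'm"
  shows "(A *v x) \<bullet> y = x \<bullet> (transpose (map_matrix cnj A) *v y)"
proof -
  have i: "u \<bullet> v = Re (u * cnj v)" for u v :: complex
    by (simp add: inner_complex_def)
  have "(A *v x) \<bullet> y = (\<Sum>i\<in>UNIV. \<Sum>j\<in>UNIV. Re (A $ i $ j * x $ j * cnj (y $ i)))"
    by (simp only: inner_vec_def i matrix_vector_mult_def vec_lambda_beta sum_distrib_right Re_sum)
  also have "\<dots> = (\<Sum>j\<in>UNIV. \<Sum>i\<in>UNIV. Re (A $ i $ j * x $ j * cnj (y $ i)))"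
    by (rule sum.swap)
  also have "\<dots> = x \<bullet> (transpose (map_matrix cnj A) *v y)"
    by (simp only: inner_vec_def i matrix_vector_mult_def vec_lambda_beta sum_distrib_left
        Re_sum cnj_sum transpose_def map_matrix_def) (simp add: mult_ac)
  finally show ?thesis .
qed

lemma normal_operator_form_lower_bound:
  fixes f g :: "complex ^ 'n \<Rightarrow> complex ^ 'n"
  assumes f: "Vector_Spaces.linear (*s) (*s) f" and g: "Vector_Spaces.linear (*s) (*s) g"
    and adj: "\<And>x y. f x \<bullet> y = x \<bullet> g y" and comm: "\<And>x. f (g x) = g (f x)"
    and eig: "\<And>v l. v \<noteq> 0 \<Longrightarrow> f v = l *s v \<Longrightarrow> m \<le> Re l"
  shows "m * (norm z)\<^sup>2 \<le> f z \<bullet> z"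
proof -
  note smult = vec.linear_scale[OF f] vec.linear_scale[OF g]
  note add = vec.linear_add[OF f] vec.linear_add[OF g] vec.linear_diff[OF f] vec.linear_diff[OF g]
  have adj': "g x \<bullet> y = x \<bullet> f y" for x y
    using adj[of y x] by (simp add: inner_commute)
  define H where "H z = (1/2) *s (f z + g z)" for z
  define K where "K z = (- \<i> / 2) *s (f z - g z)" for z
  have H_smult: "H (a *s x) = a *s H x" and K_smult: "K (a *s x) = a *s K x" for a x
    by (simp_all add: H_def K_def smult vec.scale_right_distrib vec.scale_right_diff_distrib mult_ac)
  have H_add: "H (x + y) = H x + H y" and K_add: "K (x + y) = K x + K y" for x y
    by (simp_all add: H_def K_def add vec.scale_right_distrib vec.scale_right_diff_distrib)
  have H: "linear H" and K: "linear K"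
    by (auto intro!: linearI simp: H_add K_add H_smult K_smult scaleR_eq_vector_smult)
  have H_sym: "H x \<bullet> y = x \<bullet> H y" and K_sym: "K x \<bullet> y = x \<bullet> K y" for x y
    by (simp_all add: H_def K_def inner_vector_smult_left smult adj adj' add inner_simps
        vec.scale_right_distrib vec.scale_right_diff_distrib)
  have HK: "H (K x) = K (H x)" for x
    by (simp add: H_def K_def smult add comm vec.scale_right_distrib vec.scale_right_diff_distrib mult_ac)
  have "(UNIV :: (complex ^ 'n) set) \<noteq> {0}"
    using UNIV_not_singleton by blast
  then obtain u \<mu> where u: "u \<noteq> 0" "H u = \<mu> *\<^sub>R u" and \<mu>: "\<And>z. \<mu> * (norm z)\<^sup>2 \<le> H z \<bullet> z"
    using symmetric_linear_min_eigenvector[OF H H_sym subspace_UNIV] by auto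
  define E where "E = {x. H x = \<mu> *\<^sub>R x}"
  have "subspace E"
    by (auto simp: subspace_def E_def linear_0[OF H] H_add linear_scale[OF H] algebra_simps)
  moreover have "E \<noteq> {0}" using u by (auto simp: E_def)
  moreover have "K ` E \<subseteq> E"
    by (auto simp: E_def HK linear_scale[OF K])
  ultimately obtain v \<nu> where v: "v \<in> E" "v \<noteq> 0" "K v = \<nu> *\<^sub>R v"
    using symmetric_linear_min_eigenvector[OF K K_sym] by metis
  have "f v = H v + \<i> *s K v"
    by (simp add: H_def K_def vec_eq_iff field_simps)
  also have "\<dots> = Complex \<mu> \<nu> *s v"
    using v by (simp add: E_def scaleR_eq_vector_smult vec_eq_iff algebra_simps Complex_eq)
  finally have "m \<le> \<mu>" using eig v(2) by fastforce
  then have "m * (norm z)\<^sup>2 \<le> \<mu> * (norm z)\<^sup>2" by (simp add: mult_right_mono)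
  also have "\<dots> \<le> H z \<bullet> z" by (rule \<mu>)
  also have "H z = (1/2) *\<^sub>R (f z + g z)"
    using scaleR_eq_vector_smult[of "1/2" "f z + g z"] by (simp add: H_def)
  also have "\<dots> \<bullet> z = f z \<bullet> z"
    by (simp add: inner_add_left adj' inner_commute[of z "f z"])
  finally show ?thesis .
qed

lemma normal_matrix_rotated_form_lower_bound:
  fixes A :: "complex ^ 'n ^ 'n"
  assumes normal: "normal_matrix A" and a: "a \<noteq> 0"
    and eig: "\<And>v l. v \<noteq> 0 \<Longrightarrow> A *v v = l *s v \<Longrightarrow> m \<le> Re (a * l)"
  shows "m * (norm z)\<^sup>2 \<le> (a *s (A *v z)) \<bullet> z"
proof -
  let ?B = "transpose (map_matrix cnj A)"
  have lin: "Vector_Spaces.linear (*s) (*s) (\<lambda>x. b *s (M *v x))"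
    for b :: complex and M :: "complex ^ 'n ^ 'n"
    by (intro vec.linear_compose_scale_right matrix_vector_mul_linear_gen)
  show ?thesis
  proof (rule normal_operator_form_lower_bound[OF lin lin[of "cnj a" ?B]])
    show "(a *s (A *v x)) \<bullet> y = x \<bullet> (cnj a *s (?B *v y))" for x y
      by (simp add: inner_vector_smult_left matrix_vector_mult_adjoint vector_scalar_commute)
    show "a *s (A *v (cnj a *s (?B *v x))) = cnj a *s (?B *v (a *s (A *v x)))" for x
      using normal
      by (simp add: normal_matrix_def vector_scalar_commute matrix_vector_mul_assoc mult_ac
          del: transpose_matrix_vector)
    show "m \<le> Re l" if "v \<noteq> 0" "a *s (A *v v) = l *s v" for v l
    proof -
      have "A *v v = (l / a) *s v"
        using arg_cong[OF that(2), of "(*s) (1 / a)"] a by simp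
      from eig[OF that(1) this] a show ?thesis by simp
    qed
  qed
qed

lemma Re_sesquilinear_eq_inner:
  fixes w z :: "complex ^ 'n"
  shows "Re (a * (\<Sum>k\<in>UNIV. w $ k * cnj (z $ k))) = (a *s w) \<bullet> z"
  by (simp add: inner_vec_def inner_complex_def sum_distrib_left algebra_simps)

lemma smult_inner_self: "(a *s v) \<bullet> v = Re a * (norm v)\<^sup>2" for v :: "complex ^ 'n"
  by (simp add: power2_norm_eq_inner inner_vec_def inner_complex_def sum_distrib_left algebra_simps)

lemma norm_vector_smult: "norm (a *s v) = cmod a * norm v" for v :: "complex ^ 'n"
  by (simp add: norm_vec_def norm_mult L2_set_right_distrib)

lemma eigenvalue_family_iff:
  fixes A :: "complex ^ 'n ^ 'n"
  assumes "eigenvalue_family A l"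
  shows "(\<exists>v. v \<noteq> 0 \<and> A *v v = c *s v) \<longleftrightarrow> (\<exists>j. c = l j)"
proof -
  have smult: "mat c *v v = c *s v" for v :: "complex ^ 'n"
    by (simp add: vec_eq_iff matrix_vector_mult_def mat_def if_distrib if_distribR cong: if_cong)
  have "(\<exists>j. c = l j) \<longleftrightarrow> det (mat c - A) = 0"
    using assms by (simp add: eigenvalue_family_def)
  also have "\<dots> \<longleftrightarrow> (\<exists>v. (mat c - A) *v v = 0 \<and> v \<noteq> 0)"
    using invertible_det_nz[of "mat c - A"]
    by (auto simp: invertible_left_inverse matrix_left_invertible_ker)
  also have "\<dots> \<longleftrightarrow> (\<exists>v. v \<noteq> 0 \<and> A *v v = c *s v)"
    by (simp add: matrix_vector_mult_diff_rdistrib smult) metis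
  finally show ?thesis by blast
qed

lemma norm_matrix_vector_mult_le_tensor_norm:
  "norm (A *v z) \<le> tensor_norm A * norm z"
  unfolding tensor_norm_def by (intro onorm) (simp add: linear_linear)

lemma tensor_lower_bound_le: "tensor_lower_bound A * norm z \<le> norm (A *v z)"
proof (cases "z = 0")
  case False
  then have "tensor_lower_bound A \<le> norm (A *v z) / norm z"
    unfolding tensor_lower_bound_def
    by (intro cINF_lower bdd_belowI2[where m = 0]) auto
  with False show ?thesis by (simp add: field_simps)
qed simp

lemma le_tensor_lower_bound:
  fixes A :: "complex ^ 'n ^ 'n"
  assumes "\<And>z. c * norm z \<le> norm (A *v z)"
  shows "c \<le> tensor_lower_bound A"
proof -
  have "UNIV - {0 :: complex ^ 'n} \<noteq> {}"
    using UNIV_not_singleton by blast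
  with assms show ?thesis
    unfolding tensor_lower_bound_def by (intro cINF_greatest) (auto simp: field_simps)
qed

lemma tensor_lower_bound_le_norm:
  fixes A :: "complex ^ 'n ^ 'n"
  shows "tensor_lower_bound A \<le> tensor_norm A"
proof -
  have "axis undefined 1 \<noteq> (0 :: complex ^ 'n)" by (simp add: axis_eq_0_iff)
  then have "norm (axis undefined 1 :: complex ^ 'n) > 0" by simp
  with tensor_lower_bound_le[of A "axis undefined 1"]
    norm_matrix_vector_mult_le_tensor_norm[of A "axis undefined 1"]
  show ?thesis by (meson mult_le_cancel_right_pos order_trans)
qed

lemma matrix_vector_mult_scaleR_left: "(r *\<^sub>R A) *v z = r *\<^sub>R (A *v z)" for A :: "complex ^ 'n ^ 'm"
  by (simp add: vec_eq_iff matrix_vector_mult_def scaleR_sum_right)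

lemma continuous_on_if_one_sided_lipschitz:
  fixes f :: "'a::metric_space \<Rightarrow> real"
  assumes "0 \<le> K" and le: "\<And>x y. f x \<le> f y + K * dist x y"
  shows "continuous_on UNIV f"
proof (rule lipschitz_on_continuous_on, rule lipschitz_onI)
  fix x y
  show "dist (f x) (f y) \<le> K * dist x y"
    using le[of x y] le[of y x] by (simp add: dist_real_def dist_commute abs_le_iff)
qed (rule \<open>0 \<le> K\<close>)

lemma continuous_tensor_norm_lower_bound:
  shows continuous_tensor_norm: "continuous_on UNIV (tensor_norm :: complex ^ 'n ^ 'n \<Rightarrow> real)"
    and continuous_tensor_lower_bound:
      "continuous_on UNIV (tensor_lower_bound :: complex ^ 'n ^ 'n \<Rightarrow> real)"
proof -
  have "bilinear (\<lambda>(A :: complex ^ 'n ^ 'n) z. A *v z)"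
    by (auto simp: bilinear_def intro!: linearI
        simp: matrix_vector_mult_add_rdistrib matrix_vector_mult_scaleR_left)
  then obtain K where K: "K > 0"
    and bound: "\<And>(A :: complex ^ 'n ^ 'n) z. norm (A *v z) \<le> norm A * norm z * K"
    using bounded_bilinear.pos_bounded bilinear_conv_bounded_bilinear by blast
  have step: "norm (A *v z) \<le> norm (B *v z) + K * dist A B * norm z"
    for A B :: "complex ^ 'n ^ 'n" and z
  proof -
    have "norm (A *v z) \<le> norm (B *v z) + norm ((A - B) *v z)"
      by (metis add_diff_cancel_left' diff_add_cancel matrix_vector_mult_diff_rdistrib norm_triangle_ineq)
    then show ?thesis using bound[of "A - B" z] by (simp add: dist_norm mult_ac)
  qed
  have "tensor_norm A \<le> tensor_norm B + K * dist A B" for A B :: "complex ^ 'n ^ 'n"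
    unfolding tensor_norm_def[of A]
  proof (rule onorm_le)
    show "norm (A *v z) \<le> (tensor_norm B + K * dist A B) * norm z" for z
      using step[of A z B] norm_matrix_vector_mult_le_tensor_norm[of B z]
      by (simp add: algebra_simps)
  qed
  with K show "continuous_on UNIV (tensor_norm :: complex ^ 'n ^ 'n \<Rightarrow> real)"
    by (intro continuous_on_if_one_sided_lipschitz[of K]) (auto simp: algebra_simps)
  have "tensor_lower_bound B - K * dist B A \<le> tensor_lower_bound A" for A B :: "complex ^ 'n ^ 'n"
  proof (rule le_tensor_lower_bound)
    show "(tensor_lower_bound B - K * dist B A) * norm z \<le> norm (A *v z)" for z
      using step[of B z A] tensor_lower_bound_le[of B z]
      by (simp add: algebra_simps)
  qed
  with K show "continuous_on UNIV (tensor_lower_bound :: complex ^ 'n ^ 'n \<Rightarrow> real)"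
    by (intro continuous_on_if_one_sided_lipschitz[of K]) (auto simp: algebra_simps)
qed

lemma essinf_pos_imp_AE:
  assumes "essinf M (\<lambda>x. ereal (f x)) > 0"
  obtains c where "c > 0" "AE x in M. c \<le> f x"
proof -
  have "esssup M (\<lambda>x. - ereal (f x)) < 0"
    using assms by (simp add: essinf_def ereal_uminus_less_reorder)
  then obtain r :: real where r: "esssup M (\<lambda>x. - ereal (f x)) < ereal r" "ereal r < 0"
    by (metis ereal_dense2 zero_ereal_def)
  have "AE x in M. - r \<le> f x"
    using esssup_AE[of "\<lambda>x. - ereal (f x)" M]
  proof eventually_elim
    case (elim x)
    then have "- ereal (f x) < ereal r" using r(1) by (rule le_less_trans)
    then show ?case by simp
  qed
  with r(2) show thesis by (intro that[of "- r"]) auto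
qed

lemma essinf_pos_if_AE:
  assumes f: "f \<in> borel_measurable M" and "c > 0" "AE x in M. c \<le> f x"
  shows "essinf M (\<lambda>x. ereal (f x)) > 0"
proof -
  have "esssup M (\<lambda>x. - ereal (f x)) \<le> - ereal c"
    using assms by (intro esssup_I) auto
  also have "\<dots> < 0" using \<open>c > 0\<close> by simp
  finally show ?thesis by (simp add: essinf_def ereal_uminus_less_reorder)
qed

lemma sin_le_cos_iff_mem_sectors:
  assumes \<eta>: "\<eta> \<in> {0<..pi / 2}"
  shows "sin \<eta> \<le> cos y \<longleftrightarrow>
    y \<in> (\<Union>n::int. {2 * of_int n * pi - (pi / 2 - \<eta>) .. 2 * of_int n * pi + (pi / 2 - \<eta>)})"
proof -
  have cos_shift: "cos y = cos \<bar>y - 2 * of_int n * pi\<bar>" for n :: int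
    using sin_int_2pin[of n] cos_int_2pin[of n] by (simp add: cos_diff mult_ac)
  have iff: "sin \<eta> \<le> cos y \<longleftrightarrow> \<bar>y - 2 * of_int n * pi\<bar> \<le> pi / 2 - \<eta>"
    if "\<bar>y - 2 * of_int n * pi\<bar> \<le> pi" for n :: int
    using cos_mono_le_eq[of "pi / 2 - \<eta>" "\<bar>y - 2 * of_int n * pi\<bar>"] that \<eta>
    by (simp add: cos_shift[of n] sin_cos_eq)
  define n where "n = round (y / (2 * pi))"
  have "\<bar>of_int n - y / (2 * pi)\<bar> \<le> 1 / 2"
    unfolding n_def by (rule of_int_round_abs_le)
  then have "\<bar>y - 2 * of_int n * pi\<bar> \<le> pi"
    by (simp add: abs_le_iff field_simps)
  from iff[OF this] have "sin \<eta> \<le> cos y \<Longrightarrow> \<bar>y - 2 * of_int n * pi\<bar> \<le> pi / 2 - \<eta>" by simp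
  moreover have "sin \<eta> \<le> cos y" if "\<bar>y - 2 * of_int k * pi\<bar> \<le> pi / 2 - \<eta>" for k :: int
    using iff[of k] that \<eta> by auto
  moreover have "y \<in> {2 * of_int k * pi - (pi / 2 - \<eta>) .. 2 * of_int k * pi + (pi / 2 - \<eta>)} \<longleftrightarrow>
      \<bar>y - 2 * of_int k * pi\<bar> \<le> pi / 2 - \<eta>" for k :: int
    by (auto simp: abs_le_iff)
  ultimately show ?thesis by blast
qed

lemma cos_pos_imp_half_plane:
  assumes "0 < cos y"
  obtains n :: int where "2 * of_int n * pi - pi / 2 < y" "y < 2 * of_int n * pi + pi / 2"
proof -
  have "arcsin (cos y) \<in> {0<..pi / 2}"
    using assms arcsin_less_mono[of 0 "cos y"] arcsin_bounded[of "cos y"] by auto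
  moreover from this sin_le_cos_iff_mem_sectors[OF this, of y] obtain n :: int where
    "y \<in> {2 * of_int n * pi - (pi / 2 - arcsin (cos y)) .. 2 * of_int n * pi + (pi / 2 - arcsin (cos y))}"
    by (auto simp: sin_arcsin)
  ultimately show thesis by (intro that[of n]) auto
qed

lemma angles_in_sector_iff:
  assumes "\<eta> \<in> {0<..pi / 2}"
  shows "angles_in_sector D \<beta> \<theta> \<eta> \<longleftrightarrow> (AE x in lebesgue_on D. \<forall>j. sin \<eta> \<le> cos (\<theta> + \<beta> j x))"
  unfolding angles_in_sector_def sin_le_cos_iff_mem_sectors[OF assms] ..

lemma angles_in_sector_antimono:
  assumes "angles_in_sector D \<beta> \<theta> \<eta>" "\<eta>' \<le> \<eta>"
  shows "angles_in_sector D \<beta> \<theta> \<eta>'"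
  using assms(1) unfolding angles_in_sector_def
proof eventually_elim
  case (elim x)
  show ?case
  proof
    fix j
    from elim obtain n :: int where
      "\<theta> + \<beta> j x \<in> {2 * of_int n * pi - (pi / 2 - \<eta>) .. 2 * of_int n * pi + (pi / 2 - \<eta>)}"
      by blast
    with assms(2) show "\<theta> + \<beta> j x \<in>
      (\<Union>n::int. {2 * of_int n * pi - (pi / 2 - \<eta>') .. 2 * of_int n * pi + (pi / 2 - \<eta>')})"
      by (intro UN_I[of n]) auto
  qed
qed

lemma essential_value_le:
  fixes g :: "real \<Rightarrow> real"
  assumes v: "essential_value D f v" and le: "AE x in lebesgue_on D. s \<le> g (f x)"
    and g: "isCont g v"
  shows "s \<le> g v"
proof (rule ccontr)
  assume "\<not> s \<le> g v"
  then have "\<forall>\<^sub>F y in nhds v. g y < s"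
    using g unfolding isCont_def tendsto_at_iff_tendsto_nhds by (auto intro: order_tendstoD(2)[of g "g v" "nhds v" s])
  then obtain \<epsilon> where "\<epsilon> > 0" and \<epsilon>: "\<And>y. dist y v < \<epsilon> \<Longrightarrow> g y < s"
    by (auto simp: eventually_nhds_metric)
  have "AE x in lebesgue_on D. \<bar>f x - v\<bar> \<ge> \<epsilon>"
    using le
  proof eventually_elim
    case (elim x)
    then show ?case using \<epsilon>[of "f x"] by (auto simp: dist_real_def not_less[symmetric])
  qed
  with v \<open>\<epsilon> > 0\<close> show False by (auto simp: essential_value_def)
qed

lemma ellipticity_direction_iff:
  "ellipticity_direction D \<xi> \<theta> \<longleftrightarrow> (\<exists>c>0. AE x in lebesgue_on D. \<forall>z.
    c * (norm z)\<^sup>2 \<le> (exp (\<i> * complex_of_real \<theta>) *s (\<xi> x *v z)) \<bullet> z)"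
  unfolding ellipticity_direction_def Re_sesquilinear_eq_inner ..

lemma Re_rotate_polar:
  assumes "l = complex_of_real (cmod l) * exp (\<i> * complex_of_real \<beta>)"
  shows "Re (exp (\<i> * complex_of_real \<theta>) * l) = cmod l * cos (\<theta> + \<beta>)"
proof -
  have "exp (\<i> * complex_of_real \<theta>) * l = complex_of_real (cmod l) * cis (\<theta> + \<beta>)"
    by (subst assms) (simp add: cis_conv_exp exp_add algebra_simps)
  then show ?thesis by simp
qed

lemma elliptic_imp_tensor_lower_bound:
  assumes "elliptic D \<xi>"
  obtains c where "c > 0" "AE x in lebesgue_on D. c \<le> tensor_lower_bound (\<xi> x)"
proof -
  obtain \<theta> c where "c > 0" and ae: "AE x in lebesgue_on D. \<forall>z.
      c * (norm z)\<^sup>2 \<le> (exp (\<i> * complex_of_real \<theta>) *s (\<xi> x *v z)) \<bullet> z"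
    using assms by (auto simp: elliptic_def ellipticity_direction_iff)
  have "AE x in lebesgue_on D. c \<le> tensor_lower_bound (\<xi> x)"
    using ae
  proof eventually_elim
    case (elim x)
    show ?case
    proof (rule le_tensor_lower_bound)
      fix z
      have "c * norm z * norm z \<le> norm (\<xi> x *v z) * norm z"
        using elim[rule_format, of z] norm_cauchy_schwarz[of "exp (\<i> * complex_of_real \<theta>) *s (\<xi> x *v z)" z]
        by (simp add: norm_vector_smult power2_eq_square mult_ac)
      then show "c * norm z \<le> norm (\<xi> x *v z)"
        by (cases "z = 0") auto
    qed
  qed
  with \<open>c > 0\<close> show thesis by (rule that)
qed

lemma ellipticity_direction_imp_sector:
  assumes Linfty: "Linfty_tensor D \<xi>"
    and eigenvalues: "\<forall>x\<in>D. eigenvalue_family (\<xi> x) (\<lambda>j. lam j x)"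
    and polar: "\<forall>x\<in>D. \<forall>j. lam j x =
      complex_of_real (cmod (lam j x)) * exp (\<i> * complex_of_real (\<beta> j x))"
    and dir: "ellipticity_direction D \<xi> \<theta>"
  shows "\<exists>\<eta>\<in>{0<..pi / 2}. angles_in_sector D \<beta> \<theta> \<eta>"
proof -
  obtain c where "c > 0" and ae: "AE x in lebesgue_on D. \<forall>z.
      c * (norm z)\<^sup>2 \<le> (exp (\<i> * complex_of_real \<theta>) *s (\<xi> x *v z)) \<bullet> z"
    using dir by (auto simp: ellipticity_direction_iff)
  obtain M0 where M0: "esssup (lebesgue_on D) (\<lambda>x. ereal (tensor_norm (\<xi> x))) < ereal M0"
  proof -
    have "esssup (lebesgue_on D) (\<lambda>x. ereal (tensor_norm (\<xi> x))) \<noteq> \<infinity>"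
      using Linfty by (simp add: Linfty_tensor_def)
    then show thesis unfolding less_PInf_Ex_of_nat using that by blast
  qed
  define M where "M = max M0 c"
  have M: "M \<ge> c" "M > 0" using \<open>c > 0\<close> by (auto simp: M_def)
  define \<eta> where "\<eta> = arcsin (c / M)"
  have cM: "0 < c / M" "c / M \<le> 1" using M \<open>c > 0\<close> by auto
  have \<eta>: "\<eta> \<in> {0<..pi / 2}"
    using cM arcsin_less_mono[of 0 "c / M"] arcsin_bounded[of "c / M"] by (auto simp: \<eta>_def)
  have "AE x in lebesgue_on D. \<forall>j. sin \<eta> \<le> cos (\<theta> + \<beta> j x)"
    using ae esssup_AE[of "\<lambda>x. ereal (tensor_norm (\<xi> x))" "lebesgue_on D"] AE_space
  proof eventually_elim
    case (elim x)
    have x: "x \<in> D" using elim(3) by (simp add: space_restrict_space)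
    have tM: "tensor_norm (\<xi> x) \<le> M"
    proof -
      have "ereal (tensor_norm (\<xi> x)) < ereal M0" using elim(2) M0 by (rule le_less_trans)
      then show ?thesis by (simp add: M_def)
    qed
    show ?case
    proof
      fix j
      obtain v where v: "v \<noteq> 0" "\<xi> x *v v = lam j x *s v"
        using eigenvalue_family_iff[of "\<xi> x" "\<lambda>j. lam j x" "lam j x"] eigenvalues x by blast
      have "cmod (lam j x) * norm v \<le> tensor_norm (\<xi> x) * norm v"
        using norm_matrix_vector_mult_le_tensor_norm[of "\<xi> x" v] by (simp add: v(2) norm_vector_smult)
      then have lM: "cmod (lam j x) \<le> M" using v(1) tM by simp
      have "c * (norm v)\<^sup>2 \<le> Re (exp (\<i> * complex_of_real \<theta>) * lam j x) * (norm v)\<^sup>2"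
        using elim(1)[rule_format, of v]
        by (simp add: v(2) smult_inner_self)
      then have c: "c \<le> cmod (lam j x) * cos (\<theta> + \<beta> j x)"
        using v(1) polar x Re_rotate_polar[of "lam j x" "\<beta> j x" \<theta>] by auto
      then have "0 < cmod (lam j x) * cos (\<theta> + \<beta> j x)"
        using \<open>c > 0\<close> by linarith
      then have "0 < cos (\<theta> + \<beta> j x)"
        by (simp add: zero_less_mult_iff)
      then have "c \<le> M * cos (\<theta> + \<beta> j x)"
        using c mult_right_mono[OF lM, of "cos (\<theta> + \<beta> j x)"] by linarith
      then show "sin \<eta> \<le> cos (\<theta> + \<beta> j x)"
        using cM M by (simp add: \<eta>_def field_simps)
    qed
  qed
  then show ?thesis using \<eta> angles_in_sector_iff by blast
qed

lemma ellipticity_direction_if_sector: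
  fixes \<xi> :: "real ^ 3 \<Rightarrow> complex ^ 'd::finite ^ 'd"
  assumes normal: "\<forall>x\<in>D. normal_matrix (\<xi> x)"
    and eigenvalues: "\<forall>x\<in>D. eigenvalue_family (\<xi> x) (\<lambda>j. lam j x)"
    and polar: "\<forall>x\<in>D. \<forall>j. lam j x =
      complex_of_real (cmod (lam j x)) * exp (\<i> * complex_of_real (\<beta> j x))"
    and lower: "essinf (lebesgue_on D) (\<lambda>x. ereal (tensor_lower_bound (\<xi> x))) > 0"
    and \<eta>: "\<eta> \<in> {0<..pi / 2}" and sector: "angles_in_sector D \<beta> \<theta> \<eta>"
  shows "ellipticity_direction D \<xi> \<theta>"
proof -
  obtain c where "c > 0" and c: "AE x in lebesgue_on D. c \<le> tensor_lower_bound (\<xi> x)"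
    using lower by (rule essinf_pos_imp_AE)
  have sin: "sin \<eta> > 0" using \<eta> by (intro sin_gt_zero) auto
  have "AE x in lebesgue_on D. \<forall>z.
      (c * sin \<eta>) * (norm z)\<^sup>2 \<le> (exp (\<i> * complex_of_real \<theta>) *s (\<xi> x *v z)) \<bullet> z"
    using c sector[unfolded angles_in_sector_iff[OF \<eta>]] AE_space
  proof eventually_elim
    case (elim x)
    have x: "x \<in> D" using elim(3) by (simp add: space_restrict_space)
    show ?case
    proof (intro allI normal_matrix_rotated_form_lower_bound)
      show "normal_matrix (\<xi> x)" using normal x by blast
      fix v l assume v: "v \<noteq> 0" "\<xi> x *v v = l *s v"
      then obtain j where j: "l = lam j x"
        using eigenvalue_family_iff[of "\<xi> x" "\<lambda>j. lam j x" l] eigenvalues x by blast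
      have "c * norm v \<le> cmod l * norm v"
        using tensor_lower_bound_le[of "\<xi> x" v] elim(1) mult_right_mono[of c _ "norm v"]
        by (fastforce simp: v(2) norm_vector_smult)
      then have "c \<le> cmod l" using v(1) by simp
      then have "c * sin \<eta> \<le> cmod l * cos (\<theta> + \<beta> j x)"
        using elim(2) sin \<open>c > 0\<close> by (intro mult_mono) auto
      also have "\<dots> = Re (exp (\<i> * complex_of_real \<theta>) * l)"
        using polar x j Re_rotate_polar by metis
      finally show "c * sin \<eta> \<le> Re (exp (\<i> * complex_of_real \<theta>) * l)" .
    qed simp
  qed
  with \<open>c > 0\<close> sin show ?thesis
    unfolding ellipticity_direction_iff by (intro exI[of _ "c * sin \<eta>"]) simp
qed

theorem proposition3p11:
  fixes D :: "(real ^ 3) set"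
    and \<xi> :: "real ^ 3 \<Rightarrow> complex ^ 'd ^ 'd"
    and lam :: "'d::finite \<Rightarrow> real ^ 3 \<Rightarrow> complex"
    and \<beta> :: "'d \<Rightarrow> real ^ 3 \<Rightarrow> real"
  assumes dim: "CARD('d) \<in> {1, 2, 3}"
    and bounded: "bounded D"
    and measurable: "D \<in> sets lebesgue"
    and Linfty: "Linfty_tensor D \<xi>"
    and normal: "\<forall>x\<in>D. normal_matrix (\<xi> x)"
    and eigenvalues: "\<forall>x\<in>D. eigenvalue_family (\<xi> x) (\<lambda>j. lam j x)"
    and polar: "\<forall>x\<in>D. \<forall>j. lam j x =
      complex_of_real (cmod (lam j x)) * exp (\<i> * complex_of_real (\<beta> j x))"
  shows
    "((elliptic D \<xi> \<longleftrightarrow>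
          essinf (lebesgue_on D) (\<lambda>x. ereal (tensor_lower_bound (\<xi> x))) > 0 \<and>
          (\<exists>\<theta>. \<exists>\<eta>\<in>{0<..pi / 2}. angles_in_sector D \<beta> \<theta> \<eta>)) \<and>
        (elliptic D \<xi> \<longrightarrow>
          essinf (lebesgue_on D) (\<lambda>x. ereal (tensor_norm (\<xi> x))) > 0 \<and>
          (\<exists>\<theta>. \<forall>\<epsilon>>0. \<exists>\<eta>\<in>{0<..pi / 2}. \<eta> < \<epsilon> \<and> angles_in_sector D \<beta> \<theta> \<eta>)))
     \<and> (\<forall>\<beta>m \<beta>p.
        essinf (lebesgue_on D) (\<lambda>x. ereal (tensor_lower_bound (\<xi> x))) > 0 \<and>
        (AE x in lebesgue_on D. \<forall>j. \<beta> j x \<in> {\<beta>m..\<beta>p}) \<and> \<beta>p - \<beta>m < pi \<longrightarrow>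
        elliptic D \<xi> \<and>
        (\<forall>\<theta> \<in> (\<Union>n::int. {2 * of_int n * pi - pi / 2 - \<beta>m <..< 2 * of_int n * pi + pi / 2 - \<beta>p}).
           ellipticity_direction D \<xi> \<theta>))
     \<and> (\<forall>\<beta>m \<beta>p jm jp xm xp.
        essinf (lebesgue_on D) (\<lambda>x. ereal (tensor_lower_bound (\<xi> x))) > 0 \<and>
        (AE x in lebesgue_on D. \<forall>j. \<beta> j x \<in> {\<beta>m..\<beta>p}) \<and> \<beta>p - \<beta>m < pi \<and>
        xm \<in> D \<and> \<beta> jm xm = \<beta>m \<and> essential_value D (\<beta> jm) \<beta>m \<and>
        xp \<in> D \<and> \<beta> jp xp = \<beta>p \<and> essential_value D (\<beta> jp) \<beta>p \<longrightarrow>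
        (\<forall>\<theta>. ellipticity_direction D \<xi> \<theta> \<longrightarrow>
           \<theta> \<in> (\<Union>n::int. {2 * of_int n * pi - pi / 2 - \<beta>m <..< 2 * of_int n * pi + pi / 2 - \<beta>p})))"
    (is "((_ \<longleftrightarrow> ?lower \<and> _) \<and> _) \<and> _ \<and> _")
proof -
  note sector = ellipticity_direction_imp_sector[OF Linfty eigenvalues polar]
  note dir = ellipticity_direction_if_sector[OF normal eigenvalues polar]
  have \<xi>: "\<xi> \<in> borel_measurable (lebesgue_on D)"
    using Linfty by (simp add: Linfty_tensor_def)
  have lower: ?lower if ell: "elliptic D \<xi>"
  proof -
    obtain c where "c > 0" "AE x in lebesgue_on D. c \<le> tensor_lower_bound (\<xi> x)"
      using elliptic_imp_tensor_lower_bound[OF ell] by blast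
    with borel_measurable_continuous_on[OF continuous_tensor_lower_bound \<xi>] show ?thesis
      by (rule essinf_pos_if_AE)
  qed
  have upper: "essinf (lebesgue_on D) (\<lambda>x. ereal (tensor_norm (\<xi> x))) > 0" if ell: "elliptic D \<xi>"
  proof -
    obtain c where "c > 0" "AE x in lebesgue_on D. c \<le> tensor_lower_bound (\<xi> x)"
      using elliptic_imp_tensor_lower_bound[OF ell] by blast
    moreover from this(2) have "AE x in lebesgue_on D. c \<le> tensor_norm (\<xi> x)"
      by eventually_elim (rule order_trans[OF _ tensor_lower_bound_le_norm])
    ultimately show ?thesis
      by (intro essinf_pos_if_AE borel_measurable_continuous_on[OF continuous_tensor_norm \<xi>])
  qed
  have small: "\<exists>\<theta>. \<forall>\<epsilon>>0. \<exists>\<eta>\<in>{0<..pi / 2}. \<eta> < \<epsilon> \<and> angles_in_sector D \<beta> \<theta> \<eta>" if ell: "elliptic D \<xi>"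
  proof -
    obtain \<theta> \<eta> where \<eta>: "\<eta> \<in> {0<..pi / 2}" "angles_in_sector D \<beta> \<theta> \<eta>"
      using ell sector unfolding elliptic_def by blast
    show ?thesis
    proof (intro exI[of _ \<theta>] allI impI)
      fix \<epsilon> :: real assume "\<epsilon> > 0"
      with \<eta> show "\<exists>\<eta>\<in>{0<..pi / 2}. \<eta> < \<epsilon> \<and> angles_in_sector D \<beta> \<theta> \<eta>"
        by (intro bexI[of _ "min \<eta> (\<epsilon> / 2)"] conjI angles_in_sector_antimono[OF \<eta>(2)]) auto
    qed
  qed
  have a: "elliptic D \<xi> \<longleftrightarrow> ?lower \<and> (\<exists>\<theta>. \<exists>\<eta>\<in>{0<..pi / 2}. angles_in_sector D \<beta> \<theta> \<eta>)"
    using lower sector dir unfolding elliptic_def by blast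
  have b: "ellipticity_direction D \<xi> \<theta>"
    if lower: ?lower and \<beta>: "AE x in lebesgue_on D. \<forall>j. \<beta> j x \<in> {\<beta>m..\<beta>p}"
      and \<theta>: "\<theta> \<in> {2 * of_int n * pi - pi / 2 - \<beta>m <..< 2 * of_int n * pi + pi / 2 - \<beta>p}"
    for \<beta>m \<beta>p \<theta> and n :: int
  proof -
    define \<eta> where "\<eta> = min (pi / 2) (min (\<theta> + \<beta>m - 2 * of_int n * pi + pi / 2)
      (2 * of_int n * pi + pi / 2 - \<theta> - \<beta>p))"
    have "\<eta> \<le> pi / 2" unfolding \<eta>_def by (rule min.cobounded1)
    with \<theta> have \<eta>: "\<eta> \<in> {0<..pi / 2}" by (auto simp: \<eta>_def)
    have le: "\<eta> \<le> \<theta> + \<beta>m - 2 * of_int n * pi + pi / 2" "\<eta> \<le> 2 * of_int n * pi + pi / 2 - \<theta> - \<beta>p"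
      by (simp_all add: \<eta>_def)
    have "angles_in_sector D \<beta> \<theta> \<eta>"
      unfolding angles_in_sector_def using \<beta>
    proof eventually_elim
      case (elim x)
      show ?case
      proof
        fix j
        from elim have "\<beta> j x \<in> {\<beta>m..\<beta>p}" ..
        then have "\<beta>m \<le> \<beta> j x" "\<beta> j x \<le> \<beta>p" by simp_all
        with le have "2 * of_int n * pi - (pi / 2 - \<eta>) \<le> \<theta> + \<beta> j x"
            "\<theta> + \<beta> j x \<le> 2 * of_int n * pi + (pi / 2 - \<eta>)"
          by linarith+
        then have "\<theta> + \<beta> j x \<in>
            {2 * of_int n * pi - (pi / 2 - \<eta>) .. 2 * of_int n * pi + (pi / 2 - \<eta>)}"
          by (simp only: atLeastAtMost_iff)
        then show "\<theta> + \<beta> j x \<in>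
          (\<Union>n::int. {2 * of_int n * pi - (pi / 2 - \<eta>) .. 2 * of_int n * pi + (pi / 2 - \<eta>)})"
          by (rule UN_I[OF UNIV_I])
      qed
    qed
    with lower \<eta> show ?thesis by (rule dir)
  qed
  have b': "elliptic D \<xi>"
    if "?lower" "AE x in lebesgue_on D. \<forall>j. \<beta> j x \<in> {\<beta>m..\<beta>p}" "\<beta>p - \<beta>m < pi" for \<beta>m \<beta>p
    unfolding elliptic_def using that
    by (intro exI[of _ "- (\<beta>m + \<beta>p) / 2"] b[of \<beta>m \<beta>p _ 0]) (auto simp: field_simps)
  have c: "\<theta> \<in> (\<Union>n::int. {2 * of_int n * pi - pi / 2 - \<beta>m <..< 2 * of_int n * pi + pi / 2 - \<beta>p})"
    if \<beta>: "AE x in lebesgue_on D. \<forall>j. \<beta> j x \<in> {\<beta>m..\<beta>p}" and less: "\<beta>p - \<beta>m < pi"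
      and jm: "essential_value D (\<beta> jm) \<beta>m" and jp: "essential_value D (\<beta> jp) \<beta>p"
      and \<theta>: "ellipticity_direction D \<xi> \<theta>" for \<beta>m \<beta>p jm jp \<theta>
  proof -
    obtain \<eta> where \<eta>: "\<eta> \<in> {0<..pi / 2}" "angles_in_sector D \<beta> \<theta> \<eta>"
      using sector \<theta> by blast
    have sin: "sin \<eta> > 0" using \<eta>(1) by (intro sin_gt_zero) auto
    have le_cos: "AE x in lebesgue_on D. sin \<eta> \<le> cos (\<theta> + \<beta> j x)" for j
      using \<eta>(2) unfolding angles_in_sector_iff[OF \<eta>(1)] by eventually_elim blast
    have "AE x in lebesgue_on D. \<beta>m \<le> \<beta> jp x" using \<beta> by eventually_elim auto
    from essential_value_le[OF jp this] have le: "\<beta>m \<le> \<beta>p" by simp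
    have "0 < cos (\<theta> + \<beta>m)" "0 < cos (\<theta> + \<beta>p)"
      using essential_value_le[OF jm le_cos] essential_value_le[OF jp le_cos] sin by simp_all
    then obtain n k :: int where
      n: "2 * of_int n * pi - pi / 2 < \<theta> + \<beta>m" "\<theta> + \<beta>m < 2 * of_int n * pi + pi / 2" and
      k: "2 * of_int k * pi - pi / 2 < \<theta> + \<beta>p" "\<theta> + \<beta>p < 2 * of_int k * pi + pi / 2"
      by (metis cos_pos_imp_half_plane)
    have "real_of_int k * pi < real_of_int (n + 1) * pi" "real_of_int n * pi < real_of_int (k + 1) * pi"
      using n k le less by (simp_all add: algebra_simps)
    then have "k = n" by simp
    with n k show ?thesis by (intro UN_I[of n]) auto
  qed
  show ?thesis
  proof (intro conjI allI impI ballI; (elim conjE)?)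
    show "elliptic D \<xi> \<longleftrightarrow> ?lower \<and> (\<exists>\<theta>. \<exists>\<eta>\<in>{0<..pi / 2}. angles_in_sector D \<beta> \<theta> \<eta>)"
      by (rule a)
  qed (rule upper small b' c, assumption+ | erule UN_E, rule b, assumption+)+
qed

end
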